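(* The following statements are equivalent: (1) $\mathfrak{b}>\omega_1$; (2) the product $S_\omega\times S_{\omega_1}$ is a $k_R$-space; (3) the product $S_\omega\times S_{\omega_1}$ is a $k$-space.
   Context: For an infinite cardinal $\kappa$, the sequential fan $S_\kappa$ is defined as follows. For each $\alpha\in\kappa$ let $T_\alpha$ be a (non-trivial) sequence converging to a point $x_\alpha\notin T_\alpha$. Then $S_\kappa=\{x\}\cup\bigcup_{\alpha\in\kappa}T_\alpha$ is the quotient space obtained from the topological sum $\bigoplus_{\alpha\in\kappa}(T_\alpha\cup\{x_\alpha\})$ by identifying all the points $x_\alpha$ to a single point $x$. A space $X$ is a $k$-space if a subset $C\subseteq X$ is closed in $X$ whenever $C\cap K$ is closed in $K$ for every compact $K\subseteq X$. A space $X$ is a $k_R$-space if $X$ is Tychonoff and every function $f:X\to\mathbb{R}$ whose restriction to each compact subset of $X$ is continuous is itself continuous. For $f,g\in{}^\omega\omega$ (functions from $\omega$ to $\omega$) write $f\le g$ if $f(n)\le g(n)$ for all but finitely many $n\in\omega$. A family $\mathscr{H}\subseteq{}^\omega\omega$ is bounded if there is $g\in{}^\omega\omega$ with $f\le g$ for all $f\in\mathscr{H}$, and unbounded otherwise; $\mathfrak{b}$ is the smallest cardinality of an unbounded family in ${}^\omega\omega$. Products carry the product topology. *)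

theory Defs
  imports "HOL-Analysis.Analysis"
begin

unbundle cardinal_syntax

section \<open>Sequential fans\<close>

text \<open>
  A nontrivial convergent sequence together with its limit is the one-point compactification of a
  countably infinite discrete space: the terms are \<open>Some n\<close>, the limit is \<open>None\<close>.
\<close>

definition convergent_sequence :: "nat option topology"
  where "convergent_sequence = Alexandroff_compactification (discrete_topology UNIV)"

definition collapse_limits :: "'i \<times> nat option \<Rightarrow> ('i \<times> nat) option"
  where "collapse_limits = (\<lambda>(\<alpha>, t). map_option (Pair \<alpha>) t)"

definition quotient_topology :: "'a topology \<Rightarrow> ('a \<Rightarrow> 'b) \<Rightarrow> 'b topology"
  where "quotient_topology X q =
    topology (\<lambda>U. U \<subseteq> q ` topspace X \<and> openin X {x \<in> topspace X. q x \<in> U})"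

text \<open>
  As everywhere in the library's theory of cardinals, a cardinal is a well-order relation
  \<open>\<kappa>\<close>; its elements are those of \<open>Field \<kappa>\<close>. The point \<open>Some (\<alpha>, n)\<close> of the fan is the \<open>n\<close>-th term
  of the sequence with index \<open>\<alpha>\<close>, and \<open>None\<close> is the common limit.
\<close>

definition sequential_fan :: "'i rel \<Rightarrow> ('i \<times> nat) option topology"
  where "sequential_fan \<kappa> =
    quotient_topology (sum_topology (\<lambda>_. convergent_sequence) (Field \<kappa>)) collapse_limits"

lemma istopology_quotient:
  "istopology (\<lambda>U. U \<subseteq> q ` topspace X \<and> openin X {x \<in> topspace X. q x \<in> U})"
proof -
  have "openin X {x \<in> topspace X. q x \<in> S \<inter> T}"
    if "openin X {x \<in> topspace X. q x \<in> S}" "openin X {x \<in> topspace X. q x \<in> T}" for S T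
  proof -
    have "{x \<in> topspace X. q x \<in> S \<inter> T} = {x \<in> topspace X. q x \<in> S} \<inter> {x \<in> topspace X. q x \<in> T}"
      by auto
    then show ?thesis using that by (simp add: openin_Int)
  qed
  moreover have "openin X {x \<in> topspace X. q x \<in> \<Union>\<K>}"
    if "\<And>K. K \<in> \<K> \<Longrightarrow> openin X {x \<in> topspace X. q x \<in> K}" for \<K>
  proof -
    have "{x \<in> topspace X. q x \<in> \<Union>\<K>} = (\<Union>K\<in>\<K>. {x \<in> topspace X. q x \<in> K})"
      by auto
    then show ?thesis using that by auto
  qed
  ultimately show ?thesis
    unfolding istopology_def by blast
qed

lemma openin_quotient_topology:
  "openin (quotient_topology X q) U \<longleftrightarrow>
    U \<subseteq> q ` topspace X \<and> openin X {x \<in> topspace X. q x \<in> U}"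
  unfolding quotient_topology_def by (simp add: topology_inverse'[OF istopology_quotient])

lemma topspace_quotient_topology: "topspace (quotient_topology X q) = q ` topspace X"
proof -
  have "{x \<in> topspace X. q x \<in> q ` topspace X} = topspace X"
    by auto
  then have "openin (quotient_topology X q) (q ` topspace X)"
    by (simp add: openin_quotient_topology)
  then show ?thesis
    by (meson openin_quotient_topology openin_subset openin_topspace subset_antisym)
qed

lemma quotient_map_quotient_topology: "quotient_map X (quotient_topology X q) q"
  by (auto simp: quotient_map_def topspace_quotient_topology openin_quotient_topology)

lemma topspace_convergent_sequence: "topspace convergent_sequence = UNIV"
  by (simp add: convergent_sequence_def UNIV_option_conv)

lemma openin_convergent_sequence:
  "openin convergent_sequence U \<longleftrightarrow> (None \<in> U \<longrightarrow> finite {n. Some n \<notin> U})"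
proof
  assume "openin convergent_sequence U"
  then consider V where "U = Some ` V"
    | C where "finite C" "U = insert None (Some ` (UNIV - C))"
    by (auto simp: convergent_sequence_def openin_Alexandroff_compactification
        compactin_discrete_topology)
  then show "None \<in> U \<longrightarrow> finite {n. Some n \<notin> U}"
  proof cases
    case 1
    then show ?thesis by blast
  next
    case (2 C)
    then have "{n. Some n \<notin> U} = C"
      by auto
    with 2 show ?thesis by simp
  qed
next
  assume fin: "None \<in> U \<longrightarrow> finite {n. Some n \<notin> U}"
  show "openin convergent_sequence U"
  proof (cases "None \<in> U")
    case True
    let ?C = "{n. Some n \<notin> U}"
    have "x \<in> U \<longleftrightarrow> x \<in> insert None (Some ` (UNIV - ?C))" for x
      using True by (cases x) auto
    then have "U = insert None (Some ` (UNIV - ?C))"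
      by blast
    moreover have "finite ?C"
      using fin True by simp
    ultimately have "\<exists>C. compactin (discrete_topology UNIV) C \<and> closedin (discrete_topology UNIV) C
        \<and> U = insert None (Some ` (topspace (discrete_topology UNIV) - C))"
      by (intro exI[of _ ?C]) (simp add: compactin_discrete_topology)
    then show ?thesis
      unfolding convergent_sequence_def openin_Alexandroff_compactification by (rule disjI2)
  next
    case False
    have "x \<in> U \<longleftrightarrow> x \<in> Some ` {n. Some n \<in> U}" for x
      using False by (cases x) auto
    then have "U = Some ` {n. Some n \<in> U}"
      by blast
    then have "\<exists>V. openin (discrete_topology UNIV) V \<and> U = Some ` V"
      by (intro exI[of _ "{n. Some n \<in> U}"]) simp
    then show ?thesis
      unfolding convergent_sequence_def openin_Alexandroff_compactification by (rule disjI1)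
  qed
qed

lemma collapse_limits_simps:
  "collapse_limits (\<alpha>, None) = None" "collapse_limits (\<alpha>, Some n) = Some (\<alpha>, n)"
  by (simp_all add: collapse_limits_def)

lemma topspace_sequential_fan:
  assumes "Field \<kappa> \<noteq> {}"
  shows "topspace (sequential_fan \<kappa>) = insert None (Some ` (Field \<kappa> \<times> UNIV))"
proof -
  have "topspace (sequential_fan \<kappa>) = collapse_limits ` (Field \<kappa> \<times> insert None (range Some))"
    by (simp add: sequential_fan_def topspace_quotient_topology topspace_convergent_sequence
        o_def UNIV_option_conv)
  also have "\<dots> = insert None (Some ` (Field \<kappa> \<times> UNIV))"
  proof (intro equalityI subsetI)
    fix y assume "y \<in> collapse_limits ` (Field \<kappa> \<times> insert None (range Some))"
    then show "y \<in> insert None (Some ` (Field \<kappa> \<times> UNIV))"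
      by (auto simp: collapse_limits_simps)
  next
    fix y :: "('a \<times> nat) option"
    assume y: "y \<in> insert None (Some ` (Field \<kappa> \<times> UNIV))"
    obtain \<alpha> where "\<alpha> \<in> Field \<kappa>"
      using assms by blast
    then have "None \<in> collapse_limits ` (Field \<kappa> \<times> insert None (range Some))"
      by (intro image_eqI[of _ _ "(\<alpha>, None)"]) (simp_all add: collapse_limits_simps)
    moreover have "Some (\<beta>, n) \<in> collapse_limits ` (Field \<kappa> \<times> insert None (range Some))"
      if "\<beta> \<in> Field \<kappa>" for \<beta> n
      using that by (intro image_eqI[of _ _ "(\<beta>, Some n)"]) (simp_all add: collapse_limits_simps)
    ultimately show "y \<in> collapse_limits ` (Field \<kappa> \<times> insert None (range Some))"
      using y by blast
  qed
  finally show ?thesis .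
qed

lemma openin_sequential_fan:
  assumes "Field \<kappa> \<noteq> {}"
  shows "openin (sequential_fan \<kappa>) U \<longleftrightarrow>
    U \<subseteq> insert None (Some ` (Field \<kappa> \<times> UNIV)) \<and>
    (None \<in> U \<longrightarrow> (\<forall>\<alpha>\<in>Field \<kappa>. finite {n. Some (\<alpha>, n) \<notin> U}))"
proof -
  let ?X = "sum_topology (\<lambda>_. convergent_sequence) (Field \<kappa>)"
  have top: "topspace ?X = Field \<kappa> \<times> UNIV"
    by (simp add: o_def topspace_convergent_sequence)
  have "openin ?X {p \<in> topspace ?X. collapse_limits p \<in> U} \<longleftrightarrow>
      (\<forall>\<alpha>\<in>Field \<kappa>. openin convergent_sequence {t. collapse_limits (\<alpha>, t) \<in> U})"
    unfolding openin_sum_topology top by (auto simp: o_def topspace_convergent_sequence)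
  also have "\<dots> \<longleftrightarrow> (None \<in> U \<longrightarrow> (\<forall>\<alpha>\<in>Field \<kappa>. finite {n. Some (\<alpha>, n) \<notin> U}))"
    unfolding openin_convergent_sequence by (auto simp: collapse_limits_simps)
  finally have "openin ?X {p \<in> topspace ?X. collapse_limits p \<in> U} \<longleftrightarrow>
      (None \<in> U \<longrightarrow> (\<forall>\<alpha>\<in>Field \<kappa>. finite {n. Some (\<alpha>, n) \<notin> U}))" .
  moreover have "collapse_limits ` topspace ?X = insert None (Some ` (Field \<kappa> \<times> UNIV))"
    using topspace_sequential_fan[OF assms]
    by (simp only: sequential_fan_def topspace_quotient_topology)
  ultimately show ?thesis
    unfolding sequential_fan_def openin_quotient_topology by simp
qed

section \<open>$k_R$-spaces\<close>

definition tychonoff_space :: "'a topology \<Rightarrow> bool"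
  where "tychonoff_space X \<longleftrightarrow> completely_regular_space X \<and> Hausdorff_space X"

definition k\<^sub>R_space :: "'a topology \<Rightarrow> bool"
  where "k\<^sub>R_space X \<longleftrightarrow> tychonoff_space X \<and>
    (\<forall>f :: 'a \<Rightarrow> real.
      (\<forall>K. compactin X K \<longrightarrow> continuous_map (subtopology X K) euclideanreal f) \<longrightarrow>
      continuous_map X euclideanreal f)"

section \<open>The bounding number\<close>

definition bounded_family :: "(nat \<Rightarrow> nat) set \<Rightarrow> bool"
  where "bounded_family H \<longleftrightarrow> (\<exists>g. \<forall>f\<in>H. \<forall>\<^sub>F n in cofinite. f n \<le> g n)"

definition bounding_number :: "(nat \<Rightarrow> nat) rel"  ("\<bb>")
  where "\<bb> = (SOME \<kappa>. \<kappa> \<in> {|H| | H. \<not> bounded_family H} \<and>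
                      (\<forall>\<mu> \<in> {|H| | H. \<not> bounded_family H}. \<kappa> \<le>o \<mu>))"

lemma not_bounded_family_UNIV: "\<not> bounded_family UNIV"
proof
  assume "bounded_family UNIV"
  then obtain g :: "nat \<Rightarrow> nat" where "\<forall>f. \<forall>\<^sub>F n in cofinite. f n \<le> g n"
    by (auto simp: bounded_family_def)
  then have "\<forall>\<^sub>F n in cofinite. Suc (g n) \<le> g n"
    by (rule spec)
  then show False
    by (simp add: eventually_cofinite)
qed

lemma bounding_number:
  "\<exists>H. \<not> bounded_family H \<and> \<bb> = |H|"
  "\<not> bounded_family H \<Longrightarrow> \<bb> \<le>o |H|"
proof -
  let ?R = "{|H| | H. \<not> bounded_family H}"
  have "?R \<noteq> {}"
    using not_bounded_family_UNIV by blast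
  moreover have "\<forall>\<kappa>\<in>?R. Card_order \<kappa>"
    by (auto simp: card_of_Card_order)
  ultimately have "\<exists>\<kappa>. \<kappa> \<in> ?R \<and> (\<forall>\<mu>\<in>?R. \<kappa> \<le>o \<mu>)"
    using exists_minim_Card_order[of ?R] by blast
  then have *: "\<bb> \<in> ?R \<and> (\<forall>\<mu>\<in>?R. \<bb> \<le>o \<mu>)"
    unfolding bounding_number_def by (rule someI_ex)
  then show "\<exists>H. \<not> bounded_family H \<and> \<bb> = |H|"
    by blast
  show "\<not> bounded_family H \<Longrightarrow> \<bb> \<le>o |H|"
    using * by blast
qed

section \<open>The cardinals $\omega$ and $\omega_1$\<close>

abbreviation omega :: "nat rel"  ("\<omega>")
  where "\<omega> \<equiv> natLeq"

abbreviation omega_1 :: "nat set rel"  ("\<omega>\<^sub>1")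
  where "\<omega>\<^sub>1 \<equiv> cardSuc natLeq"

end

theory Submission
  imports Defs
begin

text \<open>
  If \<open>{f\<^sub>\<alpha> | \<alpha> < \<omega>\<^sub>1}\<close> is unbounded, the points whose coordinates are the \<open>f\<^sub>\<alpha> n\<close>-th term of the
  \<open>n\<close>-th sequence and the \<open>n\<close>-th term of the \<open>\<alpha>\<close>-th sequence form a set of isolated points. A compact
  set meets only finitely many sequences, hence contains finitely many of these points, so their
  indicator function is continuous on compact sets; but they accumulate at the pair of limits.

  Conversely, let \<open>S\<close> be a set containing the pair of limits that is open on each compact set. As the
  product of a fan with a single sequence is a \<open>k\<close>-space, for each \<open>\<alpha>\<close> some basic neighbourhood lies in
  \<open>S\<close>, given by a function \<open>h\<^sub>\<alpha>\<close> for the first factor and a number for the second. If \<open>f\<close> bounds all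
  \<open>h\<^sub>\<alpha>\<close>, then \<open>f\<close> can replace \<open>h\<^sub>\<alpha>\<close> up to finitely many points, which are dealt with by enlarging the
  number.
\<close>

section \<open>Sets and functions tested on compact sets\<close>

text \<open>Continuous images of compact sets are compact, so openness on each compact set pulls
  back along \<open>g\<close>, and in a k-space it amounts to openness. This extracts open sets from
  \<open>S\<close> on slices and subproducts before \<open>S\<close> is known to be open.\<close>

lemma openin_preimage_k_open:
  assumes Y: "k_space Y" and g: "continuous_map Y X g"
    and S: "\<And>K. compactin X K \<Longrightarrow> openin (subtopology X K) (K \<inter> S)"
  shows "openin Y {y \<in> topspace Y. g y \<in> S}"
proof -
  have "openin (subtopology Y L) (L \<inter> {y \<in> topspace Y. g y \<in> S})" if L: "compactin Y L" for L
  proof -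
    have "continuous_map (subtopology Y L) (subtopology X (g ` L)) g"
      using g by (auto simp: continuous_map_in_subtopology continuous_map_from_subtopology)
    moreover have "openin (subtopology X (g ` L)) (g ` L \<inter> S)"
      using S image_compactin[OF L g] by blast
    ultimately have
      "openin (subtopology Y L) {y \<in> topspace (subtopology Y L). g y \<in> g ` L \<inter> S}"
      by (rule openin_continuous_map_preimage)
    moreover have "{y \<in> topspace (subtopology Y L). g y \<in> g ` L \<inter> S}
        = L \<inter> {y \<in> topspace Y. g y \<in> S}"
      by auto
    ultimately show ?thesis by simp
  qed
  then show ?thesis
    using Y[unfolded k_space_open, rule_format, of "{y \<in> topspace Y. g y \<in> S}"] by simp
qed

text \<open>Serves twice: for the functions witnessing complete regularity of a fan, and for the
  function refuting the \<open>k_R\<close> property.\<close>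

lemma continuous_map_indicator_clopen:
  assumes "openin X S" "closedin X S"
  shows "continuous_map X euclideanreal (indicator S)"
proof -
  have "openin X {x \<in> topspace X. indicator S x \<in> U}" for U :: "real set"
  proof -
    have "{x \<in> topspace X. indicator S x \<in> U} =
        (if 1 \<in> U then S else {}) \<union> (if 0 \<in> U then topspace X - S else {})"
      using openin_subset[OF assms(1)] by (auto simp: indicator_def)
    then show ?thesis
      using assms by (simp add: openin_Un closedin_def)
  qed
  then show ?thesis
    by (simp add: continuous_map)
qed

lemma k_space_imp_k\<^sub>R_space:
  assumes "tychonoff_space X" "k_space X"
  shows "k\<^sub>R_space X"
  unfolding k\<^sub>R_space_def using assms by (simp add: continuous_map_from_k_space)

lemma tychonoff_space_prod_topology:
  assumes "tychonoff_space X" "tychonoff_space Y"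
  shows "tychonoff_space (prod_topology X Y)"
  using assms
  by (simp add: tychonoff_space_def completely_regular_space_prod_topology
      Hausdorff_space_prod_topology)

section \<open>Sequential fans\<close>

context
  fixes \<kappa> :: "'i rel"
  assumes nonempty: "Field \<kappa> \<noteq> {}"
begin

section \<open>Neighbourhoods, separation and compact sets in a fan\<close>

lemma openin_sequential_fan_singleton:
  "\<alpha> \<in> Field \<kappa> \<Longrightarrow> openin (sequential_fan \<kappa>) {Some (\<alpha>, n)}"
  by (auto simp: openin_sequential_fan[OF nonempty])

text \<open>Thresholds on different sequences are independent, so these sets form a neighbourhood
  base at the limit; that they are small enough is \<open>sequential_fan_nhd_tails\<close>.\<close>

lemma openin_sequential_fan_tails:
  "openin (sequential_fan \<kappa>) (insert None (Some ` {(\<alpha>, n). \<alpha> \<in> Field \<kappa> \<and> f \<alpha> \<le> n}))"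
proof -
  have "{n. Some (\<alpha>, n) \<notin> insert None (Some ` {(\<alpha>, n). \<alpha> \<in> Field \<kappa> \<and> f \<alpha> \<le> n})} \<subseteq> {..<f \<alpha>}"
    if "\<alpha> \<in> Field \<kappa>" for \<alpha>
    using that by auto
  then show ?thesis
    unfolding openin_sequential_fan[OF nonempty] by (auto intro: finite_subset)
qed

lemma sequential_fan_nhd_tails:
  assumes "openin (sequential_fan \<kappa>) U" "None \<in> U"
  shows "\<exists>f. \<forall>\<alpha>\<in>Field \<kappa>. \<forall>n\<ge>f \<alpha>. Some (\<alpha>, n) \<in> U"
proof -
  have "\<exists>m. \<forall>n\<ge>m. Some (\<alpha>, n) \<in> U" if "\<alpha> \<in> Field \<kappa>" for \<alpha>
  proof -
    have "finite {n. Some (\<alpha>, n) \<notin> U}"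
      using assms that by (simp add: openin_sequential_fan[OF nonempty])
    then obtain m where "\<forall>n\<in>{n. Some (\<alpha>, n) \<notin> U}. n < m"
      using finite_nat_set_iff_bounded by blast
    then show ?thesis
      by (metis leD mem_Collect_eq)
  qed
  then show ?thesis
    by metis
qed

text \<open>Every point but the limit is isolated. Hence the complement of an open set containing
  the limit is open, and every other point is a clopen singleton.\<close>

lemma sequential_fan_clopen_nhd:
  assumes U: "openin (sequential_fan \<kappa>) U" and x: "x \<in> U"
  shows "\<exists>V. openin (sequential_fan \<kappa>) V \<and> closedin (sequential_fan \<kappa>) V \<and> x \<in> V \<and> V \<subseteq> U"
proof (cases x)
  case None
  have "openin (sequential_fan \<kappa>) (topspace (sequential_fan \<kappa>) - U)"
    using None x
    by (auto simp: openin_sequential_fan[OF nonempty] topspace_sequential_fan[OF nonempty])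
  then show ?thesis
    using U x openin_subset[OF U] by (intro exI[of _ U]) (auto simp: closedin_def)
next
  case (Some p)
  obtain \<alpha> n where p: "p = (\<alpha>, n)"
    by (cases p)
  have \<alpha>: "\<alpha> \<in> Field \<kappa>"
    using U x Some p by (auto simp: openin_sequential_fan[OF nonempty])
  have "finite {m. Some (\<beta>, m) \<notin> topspace (sequential_fan \<kappa>) - {Some (\<alpha>, n)}}"
    if "\<beta> \<in> Field \<kappa>" for \<beta>
    by (rule finite_subset[of _ "{n}"]) (use that in \<open>auto simp: topspace_sequential_fan[OF nonempty]\<close>)
  then have "openin (sequential_fan \<kappa>) (topspace (sequential_fan \<kappa>) - {Some (\<alpha>, n)})"
    unfolding openin_sequential_fan[OF nonempty] by (auto simp: topspace_sequential_fan[OF nonempty])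
  then have "closedin (sequential_fan \<kappa>) {x}"
    using U x Some p openin_subset[OF U] by (auto simp: closedin_def)
  then show ?thesis
    using openin_sequential_fan_singleton[OF \<alpha>] Some p x by (intro exI[of _ "{x}"]) auto
qed

lemma tychonoff_space_sequential_fan: "tychonoff_space (sequential_fan \<kappa>)"
proof -
  have "completely_regular_space (sequential_fan \<kappa>)"
    unfolding completely_regular_space_def
  proof (intro allI impI)
    fix S x
    assume S: "closedin (sequential_fan \<kappa>) S \<and> x \<in> topspace (sequential_fan \<kappa>) - S"
    then obtain V where V: "openin (sequential_fan \<kappa>) V" "closedin (sequential_fan \<kappa>) V" "x \<in> V"
        "V \<subseteq> topspace (sequential_fan \<kappa>) - S"
      using sequential_fan_clopen_nhd[of "topspace (sequential_fan \<kappa>) - S" x]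
      by (auto simp: closedin_def)
    \<comment> \<open>The complement is taken because the separating function has to vanish at
      \<open>x\<close> and equal 1 on \<open>S\<close>.\<close>
    let ?W = "topspace (sequential_fan \<kappa>) - V"
    have "continuous_map (sequential_fan \<kappa>) euclideanreal (indicator ?W)"
      using V by (intro continuous_map_indicator_clopen) (auto simp: closedin_def double_diff)
    moreover have "S \<subseteq> ?W" "x \<notin> ?W"
      using V S closedin_subset by blast+
    ultimately show "\<exists>f::_ \<Rightarrow> real. continuous_map (sequential_fan \<kappa>) (top_of_set {0..1}) f \<and>
        f x = 0 \<and> f ` S \<subseteq> {1}"
      by (intro exI[of _ "indicator ?W"])
        (auto simp: continuous_map_in_subtopology indicator_def)
  qed
  moreover have "Hausdorff_space (sequential_fan \<kappa>)"
    unfolding Hausdorff_space_def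
  proof (intro allI impI)
    fix x y
    assume xy: "x \<in> topspace (sequential_fan \<kappa>) \<and> y \<in> topspace (sequential_fan \<kappa>) \<and> x \<noteq> y"
    have "\<exists>U. openin (sequential_fan \<kappa>) U \<and> a \<in> U \<and> b \<notin> U"
      if "a \<in> topspace (sequential_fan \<kappa>)" "a \<noteq> b" for a b
    proof (cases a)
      case None
      \<comment> \<open>The threshold \<open>Suc m\<close> excludes \<open>b\<close>. The missing
        case \<open>None\<close> cannot occur, since \<open>a\<close> is \<open>None\<close> and
        differs from \<open>b\<close>.\<close>
      then show ?thesis
        using that openin_sequential_fan_tails[of "case b of Some (\<beta>, m) \<Rightarrow> (\<lambda>_. Suc m)"]
        by (cases b) force+
    next
      case (Some p)
      then show ?thesis
        using that openin_sequential_fan_singleton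
        by (cases p) (auto simp: topspace_sequential_fan[OF nonempty])
    qed
    then obtain U where "openin (sequential_fan \<kappa>) U" "x \<in> U" "y \<notin> U"
      using xy by blast
    \<comment> \<open>A clopen \<open>V\<close> turns the one-sided separation into a two-sided one,
      by \<open>V\<close> and its complement.\<close>
    then obtain V where "openin (sequential_fan \<kappa>) V" "closedin (sequential_fan \<kappa>) V" "x \<in> V" "y \<notin> V"
      using sequential_fan_clopen_nhd by blast
    then show "\<exists>U V. openin (sequential_fan \<kappa>) U \<and> openin (sequential_fan \<kappa>) V \<and>
        x \<in> U \<and> y \<in> V \<and> disjnt U V"
      using xy
      by (intro exI[of _ V] exI[of _ "topspace (sequential_fan \<kappa>) - V"])
        (auto simp: closedin_def disjnt_def)
  qed
  ultimately show ?thesis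
    by (simp add: tychonoff_space_def)
qed

text \<open>Choose one point of \<open>K\<close> on each sequence that \<open>K\<close> meets. Tails
  starting just past the chosen points avoid all of them, so they do not accumulate anywhere, and
  compactness allows only finitely many.\<close>

lemma compactin_sequential_fan_finite:
  assumes K: "compactin (sequential_fan \<kappa>) K"
  shows "finite {\<alpha>. \<exists>n. Some (\<alpha>, n) \<in> K}"
proof -
  define p where "p \<alpha> = (SOME n. Some (\<alpha>, n) \<in> K)" for \<alpha>
  define D where "D = (\<lambda>\<alpha>. Some (\<alpha>, p \<alpha>)) ` {\<alpha>. \<exists>n. Some (\<alpha>, n) \<in> K}"
  have "D \<subseteq> K"
    unfolding D_def p_def using someI_ex by fast
  moreover have "sequential_fan \<kappa> derived_set_of D = {}"
  proof -
    have "\<exists>T. x \<in> T \<and> openin (sequential_fan \<kappa>) T \<and> (\<forall>y\<in>D. y = x \<or> y \<notin> T)"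
      if "x \<in> topspace (sequential_fan \<kappa>)" for x
    proof (cases x)
      case None
      have "y \<notin> insert None (Some ` {(\<alpha>, n). \<alpha> \<in> Field \<kappa> \<and> Suc (p \<alpha>) \<le> n})" if "y \<in> D" for y
        using that by (auto simp: D_def)
      then show ?thesis
        using None openin_sequential_fan_tails[of "\<lambda>\<alpha>. Suc (p \<alpha>)"] by blast
    next
      case (Some q)
      then have "openin (sequential_fan \<kappa>) {x}"
        using that openin_sequential_fan_singleton
        by (auto simp: topspace_sequential_fan[OF nonempty])
      then show ?thesis
        by blast
    qed
    then show ?thesis
      by (fastforce simp: derived_set_of_def)
  qed
  ultimately have "finite D"
    using compactin_imp_Bolzano_Weierstrass[OF K, of D] by auto
  then show ?thesis
    unfolding D_def by (rule finite_imageD) (auto simp: inj_on_def)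
qed

section \<open>Fans as k-spaces\<close>

lemma continuous_map_collapse_limits:
  assumes "\<alpha> \<in> Field \<kappa>"
  shows "continuous_map convergent_sequence (sequential_fan \<kappa>) (\<lambda>t. collapse_limits (\<alpha>, t))"
proof -
  have "continuous_map convergent_sequence (sum_topology (\<lambda>_. convergent_sequence) (Field \<kappa>)) (Pair \<alpha>)"
    using continuous_map_component_injection[OF assms] .
  then show ?thesis
    using continuous_map_compose[OF _ quotient_imp_continuous_map[OF quotient_map_quotient_topology]]
    unfolding sequential_fan_def o_def by blast
qed

text \<open>A sum of compact sequences is locally compact, hence a k-space, and quotients of
  k-spaces are k-spaces.\<close>

lemma k_space_sequential_fan: "k_space (sequential_fan \<kappa>)"
  unfolding sequential_fan_def
proof (rule k_space_quotient_map_image[OF quotient_map_quotient_topology])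
  show "k_space (sum_topology (\<lambda>_. convergent_sequence) (Field \<kappa>))"
    by (intro locally_compact_imp_k_space)
      (simp add: locally_compact_space_sum_topology convergent_sequence_def
        compact_imp_locally_compact_space)
qed

end

section \<open>Products of sequential fans\<close>

text \<open>The second factor is compact Hausdorff, so the product stays a k-space. A fan need not
  be locally compact, which is why a product of two fans is treated one sequence of the second
  factor at a time.\<close>

lemma k_space_prod_sequential_fan_convergent_sequence:
  assumes "Field \<kappa> \<noteq> {}"
  shows "k_space (prod_topology (sequential_fan \<kappa>) convergent_sequence)"
proof (rule k_space_prod_topology_right[OF k_space_sequential_fan[OF assms]])
  show "locally_compact_space convergent_sequence"
    by (simp add: convergent_sequence_def compact_imp_locally_compact_space)
  show "Hausdorff_space convergent_sequence \<or> regular_space convergent_sequence"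
    by (simp add: convergent_sequence_def Hausdorff_space_Alexandroff_compactification
        locally_compact_space_discrete_topology)
qed

text \<open>Openness is checked pointwise. Away from the pair of limits one coordinate is isolated
  and an open slice suffices; the bound is needed only at that pair.\<close>

lemma k_space_prod_sequential_fan:
  fixes \<kappa> :: "'i rel"
  assumes nonempty: "Field \<kappa> \<noteq> {}"
    and bounded: "\<And>h. bounded_family (h ` Field \<kappa>)"
  shows "k_space (prod_topology (sequential_fan \<omega>) (sequential_fan \<kappa>))"
  unfolding k_space_open openin_prod_topology_alt
proof (intro allI impI, elim conjE)
  let ?X = "sequential_fan \<omega>" and ?Y = "sequential_fan \<kappa>"
  let ?P = "prod_topology ?X ?Y"
  have nonempty\<^sub>\<omega>: "Field \<omega> \<noteq> {}"
    by (simp add: Field_natLeq)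
  fix S x y
  assume S: "S \<subseteq> topspace ?P" and xy: "(x, y) \<in> S"
    and "\<forall>K. compactin ?P K \<longrightarrow> openin (subtopology ?P K) (K \<inter> S)"
  then have k_open: "openin (subtopology ?P K) (K \<inter> S)" if "compactin ?P K" for K
    using that by blast
  have slice_left: "openin ?X {u \<in> topspace ?X. (u, v) \<in> S}" if "v \<in> topspace ?Y" for v
    using that by (intro openin_preimage_k_open[OF k_space_sequential_fan[OF nonempty\<^sub>\<omega>] _ k_open])
      (simp_all add: continuous_map_paired)
  have slice_right: "openin ?Y {v \<in> topspace ?Y. (u, v) \<in> S}" if "u \<in> topspace ?X" for u
    using that by (intro openin_preimage_k_open[OF k_space_sequential_fan[OF nonempty] _ k_open])
      (simp_all add: continuous_map_paired)
  have xy_top: "x \<in> topspace ?X" "y \<in> topspace ?Y"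
    using S xy by auto
  show "\<exists>U V. openin ?X U \<and> openin ?Y V \<and> x \<in> U \<and> y \<in> V \<and> U \<times> V \<subseteq> S"
  proof (cases "x = None \<and> y = None")
    case False
    then consider n i where "x = Some (n, i)" | \<alpha> k where "y = Some (\<alpha>, k)"
      by (metis option.exhaust surj_pair)
    then show ?thesis
    proof cases
      case 1
      then have "openin ?X {x}"
        by (simp add: openin_sequential_fan_singleton[OF nonempty\<^sub>\<omega>] Field_natLeq)
      then show ?thesis
        using slice_right xy xy_top
        by (intro exI[of _ "{x}"] exI[of _ "{v \<in> topspace ?Y. (x, v) \<in> S}"]) auto
    next
      case 2
      then have "openin ?Y {y}"
        using xy_top openin_sequential_fan_singleton[OF nonempty]
        by (auto simp: topspace_sequential_fan[OF nonempty])
      then show ?thesis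
        using slice_left xy xy_top
        by (intro exI[of _ "{u \<in> topspace ?X. (u, y) \<in> S}"] exI[of _ "{y}"]) auto
    qed
  next
    case True
    \<comment> \<open>Pulling \<open>S\<close> back to the product of the first fan with the
      \<alpha>-th sequence gives a box, whose second side is a tail with a single threshold
      \<open>k\<close>.\<close>
    have "\<exists>h k. \<forall>n i j. h n \<le> i \<longrightarrow> k \<le> j \<longrightarrow> (Some (n, i), Some (\<alpha>, j)) \<in> S"
      if \<alpha>: "\<alpha> \<in> Field \<kappa>" for \<alpha>
    proof -
      let ?Q = "prod_topology ?X convergent_sequence"
      let ?g = "\<lambda>(u, t). (u, collapse_limits (\<alpha>, t))"
      have "continuous_map ?Q ?P ?g"
        using continuous_map_collapse_limits[OF nonempty \<alpha>]
        by (simp add: continuous_map_prod_top)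
      then have "openin ?Q {q \<in> topspace ?Q. ?g q \<in> S}"
        by (rule openin_preimage_k_open[OF k_space_prod_sequential_fan_convergent_sequence[OF
                nonempty\<^sub>\<omega>] _ k_open])
      moreover have "(None, None) \<in> {q \<in> topspace ?Q. ?g q \<in> S}"
        using True xy xy_top by (simp add: collapse_limits_simps topspace_convergent_sequence)
      ultimately obtain U V where U: "openin ?X U" "None \<in> U"
        and V: "openin convergent_sequence V" "None \<in> V"
        and UV: "U \<times> V \<subseteq> {q \<in> topspace ?Q. ?g q \<in> S}"
        unfolding openin_prod_topology_alt by meson
      obtain h where h: "\<And>n i. h n \<le> i \<Longrightarrow> Some (n, i) \<in> U"
        using sequential_fan_nhd_tails[OF nonempty\<^sub>\<omega> U] by (auto simp: Field_natLeq)
      obtain k where k: "\<And>j. k \<le> j \<Longrightarrow> Some j \<in> V"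
        using V finite_nat_set_iff_bounded[of "{n. Some n \<notin> V}"]
        by (auto simp: openin_convergent_sequence) (meson leD)
      have "(Some (n, i), Some (\<alpha>, j)) \<in> S" if "h n \<le> i" "k \<le> j" for n i j
        using subsetD[OF UV, of "(Some (n, i), Some j)"] h[OF that(1)] k[OF that(2)]
        by (simp add: collapse_limits_simps)
      then show ?thesis
        by blast
    qed
    then obtain h k where hk: "\<And>\<alpha> n i j. \<alpha> \<in> Field \<kappa> \<Longrightarrow> h \<alpha> n \<le> i \<Longrightarrow> k \<alpha> \<le> j \<Longrightarrow>
        (Some (n, i), Some (\<alpha>, j)) \<in> S"
      by metis
    \<comment> \<open>One \<open>b\<close> serves all \<alpha>, but the finite exceptional set
      depends on \<alpha>.\<close>
    obtain b where b: "\<And>\<alpha>. \<alpha> \<in> Field \<kappa> \<Longrightarrow> finite {n. \<not> h \<alpha> n \<le> b n}"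
      using bounded[of h] by (auto simp: bounded_family_def eventually_cofinite)
    have tops: "None \<in> topspace ?X" "None \<in> topspace ?Y"
      using True xy_top by auto
    have limits: "None \<in> {u \<in> topspace ?X. (u, None) \<in> S}" "None \<in> {v \<in> topspace ?Y. (None, v) \<in> S}"
      using True xy tops by auto
    \<comment> \<open>\<open>f\<^sub>0\<close> and \<open>g\<^sub>0\<close> handle the points with
      exactly one coordinate at a limit, about which \<open>hk\<close> says nothing.\<close>
    obtain f\<^sub>0 where f\<^sub>0: "\<And>n i. f\<^sub>0 n \<le> i \<Longrightarrow> (Some (n, i), None) \<in> S"
      using sequential_fan_nhd_tails[OF nonempty\<^sub>\<omega> slice_left[OF tops(2)] limits(1)]
      by (auto simp: Field_natLeq)
    obtain g\<^sub>0 where g\<^sub>0: "\<And>\<alpha> j. \<alpha> \<in> Field \<kappa> \<Longrightarrow> g\<^sub>0 \<alpha> \<le> j \<Longrightarrow> (None, Some (\<alpha>, j)) \<in> S"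
      using sequential_fan_nhd_tails[OF nonempty slice_right[OF tops(1)] limits(2)] by auto
    define f where "f n = max (f\<^sub>0 n) (b n)" for n
    have "\<exists>m. \<forall>j\<ge>m. \<forall>n i. f n \<le> i \<longrightarrow> (Some (n, i), Some (\<alpha>, j)) \<in> S" if \<alpha>: "\<alpha> \<in> Field \<kappa>" for \<alpha>
    proof -
      define E where "E = Sigma {n. \<not> h \<alpha> n \<le> b n} (\<lambda>n. {f n..<h \<alpha> n})"
      have "finite E"
        unfolding E_def using b[OF \<alpha>] by blast
      \<comment> \<open>As \<open>f\<close> dominates \<open>f\<^sub>0\<close>, the slice through
        \<open>e\<close> contains the limit of the second fan, hence a tail of the \<alpha>-th
        sequence. Finiteness of \<open>E\<close> then gives a common threshold.\<close>
      moreover have "\<forall>\<^sub>F j in sequentially. (Some e, Some (\<alpha>, j)) \<in> S" if "e \<in> E" for e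
      proof -
        obtain n i where e: "e = (n, i)"
          by (cases e)
        then have "(Some e, None) \<in> S"
          using that f\<^sub>0 by (auto simp: E_def f_def)
        moreover from this have "Some e \<in> topspace ?X" "None \<in> topspace ?Y"
          using S by auto
        ultimately obtain m where "\<And>j. m \<le> j \<Longrightarrow> (Some e, Some (\<alpha>, j)) \<in> S"
          using sequential_fan_nhd_tails[OF nonempty slice_right[of "Some e"]] \<alpha> by auto
        then show ?thesis
          by (auto simp: eventually_sequentially)
      qed
      ultimately have "\<forall>\<^sub>F j in sequentially. \<forall>e\<in>E. (Some e, Some (\<alpha>, j)) \<in> S"
        by (simp add: eventually_ball_finite)
      then obtain m where m: "\<And>j e. m \<le> j \<Longrightarrow> e \<in> E \<Longrightarrow> (Some e, Some (\<alpha>, j)) \<in> S"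
        by (auto simp: eventually_sequentially)
      have "(Some (n, i), Some (\<alpha>, j)) \<in> S" if j: "max m (k \<alpha>) \<le> j" and i: "f n \<le> i" for n i j
      proof (cases "h \<alpha> n \<le> i")
        case True
        then show ?thesis
          using hk[OF \<alpha>] j by simp
      next
        case False
        then have "(n, i) \<in> E"
          using i by (auto simp: E_def f_def)
        then show ?thesis
          using m j by simp
      qed
      then show ?thesis
        by blast
    qed
    then obtain g where g: "\<And>\<alpha> n i j. \<alpha> \<in> Field \<kappa> \<Longrightarrow> g \<alpha> \<le> j \<Longrightarrow> f n \<le> i \<Longrightarrow>
        (Some (n, i), Some (\<alpha>, j)) \<in> S"
      by metis
    let ?U = "insert None (Some ` {(n, i). n \<in> Field \<omega> \<and> f n \<le> i})"
    let ?V = "insert None (Some ` {(\<alpha>, j). \<alpha> \<in> Field \<kappa> \<and> max (g \<alpha>) (g\<^sub>0 \<alpha>) \<le> j})"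
    have "?U \<times> ?V \<subseteq> S"
      using f\<^sub>0 g\<^sub>0 g True xy by (auto simp: f_def)
    then show ?thesis
      using True openin_sequential_fan_tails[OF nonempty\<^sub>\<omega>, of f]
        openin_sequential_fan_tails[OF nonempty, of "\<lambda>\<alpha>. max (g \<alpha>) (g\<^sub>0 \<alpha>)"]
      by (intro exI[of _ ?U] exI[of _ ?V]) auto
  qed
qed

lemma not_k\<^sub>R_space_prod_sequential_fan:
  fixes \<kappa> :: "'i rel"
  assumes nonempty: "Field \<kappa> \<noteq> {}"
    and unbounded: "\<not> bounded_family (f ` Field \<kappa>)"
  shows "\<not> k\<^sub>R_space (prod_topology (sequential_fan \<omega>) (sequential_fan \<kappa>))"
proof
  let ?X = "sequential_fan \<omega>" and ?Y = "sequential_fan \<kappa>"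
  let ?P = "prod_topology ?X ?Y"
  assume k\<^sub>R: "k\<^sub>R_space ?P"
  have nonempty\<^sub>\<omega>: "Field \<omega> \<noteq> {}"
    by (simp add: Field_natLeq)
  \<comment> \<open>The number \<open>n\<close> is the index of a sequence in the first fan and also
    the position in the second, so \<open>v \<alpha> \<le> n\<close> and
    \<open>u n \<le> f \<alpha> n\<close> put the point into the box given by \<open>u\<close> and
    \<open>v\<close>.\<close>
  define q where "q = (\<lambda>(n, \<alpha>). (Some (n, f \<alpha> n), Some (\<alpha>, n)))"
  define A where "A = q ` (UNIV \<times> Field \<kappa>)"
  have open_A: "openin ?P B" if "B \<subseteq> A" for B
  proof -
    have "openin ?P {p}" if "p \<in> A" for p
    proof -
      obtain n \<alpha> where p: "p = (Some (n, f \<alpha> n), Some (\<alpha>, n))" "\<alpha> \<in> Field \<kappa>"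
        using \<open>p \<in> A\<close> by (auto simp: A_def q_def)
      then have "openin ?P ({Some (n, f \<alpha> n)} \<times> {Some (\<alpha>, n)})"
        by (simp only: openin_prod_Times_iff)
          (simp add: openin_sequential_fan_singleton nonempty Field_natLeq)
      then show ?thesis
        using p by simp
    qed
    then have "openin ?P (\<Union>p\<in>B. {p})"
      using that by blast
    then show ?thesis by simp
  qed
  have "continuous_map (subtopology ?P K) euclideanreal (indicator A)" if K: "compactin ?P K" for K
  proof -
    \<comment> \<open>A point of \<open>A\<close> is determined by the indices of its two sequences,
      and \<open>K\<close> meets finitely many sequences in each factor.\<close>
    have "finite {n. \<exists>i. Some (n, i) \<in> fst ` K}" "finite {\<alpha>. \<exists>i. Some (\<alpha>, i) \<in> snd ` K}"
      using compactin_sequential_fan_finite[OF nonempty\<^sub>\<omega> image_compactin[OF K continuous_map_fst]]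
        compactin_sequential_fan_finite[OF nonempty image_compactin[OF K continuous_map_snd]]
      by blast+
    then have "finite (q ` ({n. \<exists>i. Some (n, i) \<in> fst ` K} \<times> {\<alpha>. \<exists>i. Some (\<alpha>, i) \<in> snd ` K}))"
      by blast
    moreover have "A \<inter> K \<subseteq> q ` ({n. \<exists>i. Some (n, i) \<in> fst ` K} \<times> {\<alpha>. \<exists>i. Some (\<alpha>, i) \<in> snd ` K})"
      by (force simp: A_def q_def)
    ultimately have "finite (A \<inter> K)"
      by (rule rev_finite_subset)
    moreover have "A \<inter> K \<subseteq> topspace ?P"
      using compactin_subset_topspace[OF K] by blast
    moreover have "Hausdorff_space ?P"
      using k\<^sub>R by (simp add: k\<^sub>R_space_def tychonoff_space_def)
    ultimately have "closedin ?P (A \<inter> K)"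
      by (simp add: closedin_Hausdorff_finite)
    \<comment> \<open>The finite set \<open>A \<inter> K\<close> is clopen in the whole product, and
      its indicator agrees with that of \<open>A\<close> on \<open>K\<close>.\<close>
    then have "continuous_map ?P euclideanreal (indicator (A \<inter> K))"
      using open_A[of "A \<inter> K"] by (intro continuous_map_indicator_clopen) auto
    then have "continuous_map (subtopology ?P K) euclideanreal (indicator (A \<inter> K))"
      by (rule continuous_map_from_subtopology)
    then show ?thesis
      by (rule continuous_map_eq) (auto simp: indicator_def)
  qed
  then have "continuous_map ?P euclideanreal (indicator A)"
    using k\<^sub>R by (simp add: k\<^sub>R_space_def)
  then have "openin ?P {p \<in> topspace ?P. indicator A p \<in> {..<1::real}}"
    by (rule openin_continuous_map_preimage) simp
  moreover have "(None, None) \<in> {p \<in> topspace ?P. indicator A p \<in> {..<1::real}}"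
    by (auto simp: topspace_sequential_fan nonempty Field_natLeq A_def q_def indicator_def)
  ultimately obtain U V where U: "openin ?X U" "None \<in> U" and V: "openin ?Y V" "None \<in> V"
    and UV: "U \<times> V \<subseteq> {p \<in> topspace ?P. indicator A p \<in> {..<1::real}}"
    unfolding openin_prod_topology_alt by meson
  obtain u where u: "\<And>n i. u n \<le> i \<Longrightarrow> Some (n, i) \<in> U"
    using sequential_fan_nhd_tails[OF nonempty\<^sub>\<omega> U] by (auto simp: Field_natLeq)
  obtain v where v: "\<And>\<alpha> j. \<alpha> \<in> Field \<kappa> \<Longrightarrow> v \<alpha> \<le> j \<Longrightarrow> Some (\<alpha>, j) \<in> V"
    using sequential_fan_nhd_tails[OF nonempty V] by blast
  obtain \<alpha> where \<alpha>: "\<alpha> \<in> Field \<kappa>" "infinite {n. \<not> f \<alpha> n \<le> u n}"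
    using unbounded by (auto simp: bounded_family_def eventually_cofinite)
  \<comment> \<open>Infinitely many failures of the bound are needed here: one must lie beyond
    \<open>v \<alpha>\<close>, which was fixed before \<open>n\<close>.\<close>
  then have "\<exists>n\<ge>v \<alpha>. n \<in> {n. \<not> f \<alpha> n \<le> u n}"
    by (simp only: infinite_nat_iff_unbounded_le)
  then obtain n where n: "v \<alpha> \<le> n" "\<not> f \<alpha> n \<le> u n"
    by blast
  then have "q (n, \<alpha>) \<in> U \<times> V"
    using u v \<alpha> by (simp add: q_def)
  then have "indicator A (q (n, \<alpha>)) < (1::real)"
    using UV by auto
  moreover have "q (n, \<alpha>) \<in> A"
    using \<alpha> by (simp add: A_def)
  ultimately show False
    by simp
qed

text \<open>A nonempty family has size at most \<kappa> exactly when it is an image of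
  \<open>Field \<kappa>\<close>, and unbounded families are nonempty. This passes from cardinals to
  the indexed families of the two product lemmas.\<close>

lemma bounding_number_le_iff:
  assumes "Card_order \<kappa>" "Field \<kappa> \<noteq> {}"
  shows "\<bb> \<le>o \<kappa> \<longleftrightarrow> (\<exists>h. \<not> bounded_family (h ` Field \<kappa>))"
proof
  assume le: "\<bb> \<le>o \<kappa>"
  obtain H where H: "\<not> bounded_family H" "\<bb> = |H|"
    using bounding_number(1) by blast
  then have "|H| \<le>o |Field \<kappa>|"
    using le ordIso_symmetric[OF card_of_Field_ordIso[OF assms(1)]] by (auto intro: ordLeq_ordIso_trans)
  moreover have "H \<noteq> {}"
    using H by (auto simp: bounded_family_def)
  ultimately obtain h where "h ` Field \<kappa> = H"
    using card_of_ordLeq2 by metis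
  then show "\<exists>h. \<not> bounded_family (h ` Field \<kappa>)"
    using H by blast
next
  assume "\<exists>h. \<not> bounded_family (h ` Field \<kappa>)"
  then obtain h :: "_ \<Rightarrow> nat \<Rightarrow> nat" where "\<bb> \<le>o |h ` Field \<kappa>|"
    using bounding_number(2) by blast
  then have "\<bb> \<le>o |Field \<kappa>|"
    using card_of_image by (rule ordLeq_transitive)
  then show "\<bb> \<le>o \<kappa>"
    using card_of_Field_ordIso[OF assms(1)] by (rule ordLeq_ordIso_trans)
qed

theorem theorem3p4:
  shows "(\<omega>\<^sub>1 <o \<bb> \<longleftrightarrow> k\<^sub>R_space (prod_topology (sequential_fan \<omega>) (sequential_fan \<omega>\<^sub>1))) \<and>
    (k\<^sub>R_space (prod_topology (sequential_fan \<omega>) (sequential_fan \<omega>\<^sub>1)) \<longleftrightarrow>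
      k_space (prod_topology (sequential_fan \<omega>) (sequential_fan \<omega>\<^sub>1)))"
proof -
  let ?P = "prod_topology (sequential_fan \<omega>) (sequential_fan \<omega>\<^sub>1)"
  have card: "Card_order \<omega>\<^sub>1"
    by (simp add: cardSuc_Card_order natLeq_Card_order)
  have nonempty: "Field \<omega> \<noteq> {}" "Field \<omega>\<^sub>1 \<noteq> {}"
    using Field_cardSuc_not_empty[OF natLeq_Card_order] by (simp_all add: Field_natLeq)
  have "Well_order \<bb>"
    using bounding_number(1) card_of_Well_order by metis
  then have "\<omega>\<^sub>1 <o \<bb> \<longleftrightarrow> \<not> \<bb> \<le>o \<omega>\<^sub>1"
    using card by (simp add: not_ordLeq_iff_ordLess card_order_on_well_order_on)
  then have b: "\<omega>\<^sub>1 <o \<bb> \<longleftrightarrow> (\<forall>h. bounded_family (h ` Field \<omega>\<^sub>1))"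
    using bounding_number_le_iff[OF card nonempty(2)] by blast
  \<comment> \<open>The cycle runs from the bound on \<open>\<bb>\<close> to k-space, then to
    \<open>k_R\<close>-space, and back.\<close>
  have "k_space ?P" if "\<omega>\<^sub>1 <o \<bb>"
    using that b k_space_prod_sequential_fan[OF nonempty(2)] by blast
  moreover have "k\<^sub>R_space ?P" if "k_space ?P"
    using that nonempty
    by (intro k_space_imp_k\<^sub>R_space tychonoff_space_prod_topology tychonoff_space_sequential_fan)
  moreover have "\<omega>\<^sub>1 <o \<bb>" if "k\<^sub>R_space ?P"
    using that b not_k\<^sub>R_space_prod_sequential_fan[OF nonempty(2)] by blast
  ultimately show ?thesis
    by blast
qed

end
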